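(* Let $A,B\in\mathbb{C}^{n\times n}$, $\sigma\in\mathbb{C}$, and let $k$ be the rank of $A-\sigma B$. Let $F$ and $G$ be the border matrices determined by the bordered LU factorization procedure (described in the context) applied to the matrix $A-\sigma B$. Then the number of columns of $F$ and of $G$ is $n-k$.
   Context: Bordered LU factorization procedure (exact arithmetic), applied to a matrix $M\in\mathbb{C}^{n\times n}$ (here $M=A-\sigma B$), with a fixed scalar $\alpha\neq 0$. It performs steps $i=1,\dots,n$. After step $i$ there are border matrices $F_i,G_i\in\mathbb{C}^{n\times(n_i-n)}$, the bordered matrix $\mathbf{M}_i=\begin{bmatrix} M & G_i\\ F_i^* & 0\end{bmatrix}\in\mathbb{C}^{n_i\times n_i}$, permutation matrices $P_i,Q_i$ of order $n_i$, and a partial factorization $P_i\mathbf{M}_iQ_i=L_iU_i$ with $$L_i=\begin{bmatrix} L_{1,1}^{(i)} & 0\\ L_{2,1}^{(i)} & I\end{bmatrix},\qquad U_i=\begin{bmatrix} U_{1,1}^{(i)} & U_{1,2}^{(i)}\\ 0 & U_{2,2}^{(i)}\end{bmatrix},$$ where $L_{1,1}^{(i)}$ is $i\times i$ unit lower triangular, $U_{1,1}^{(i)}$ is $i\times i$ upper triangular and invertible, and $U_{2,2}^{(i)}$ is the Schur complement. Initially $n_0=n$, $F_0,G_0$ are empty, $P_0=Q_0=L_0=I_n$, $U_0=M$. Step $i$: a pivoting strategy (e.g. partial, rook or complete pivoting) searches a pivot in $U_{i-1}$ among rows $i,\dots,n_{i-1}$ and columns $i,\dots,n$ (never among the columns coming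 from $G$). (1) If a nonzero pivot is found at position $(p_r,p_c)$, rows $i,p_r$ and columns $i,p_c$ are interchanged (also in the accumulated permutations and in the already computed part of $L$), one usual step of Gaussian elimination is performed, and $n_i=n_{i-1}$. (2) (Breakdown.) If the strategy finds no nonzero pivot, i.e. the selected column $p_c\in\{i,\dots,n\}$ has only zeros in rows $i,\dots,n_{i-1}$ of $U_{i-1}$, columns $i$ and $p_c$ are interchanged, giving the accumulated column permutation $\widetilde Q_i$. Then one column is added to each of $F$ and $G$, so $n_i=n_{i-1}+1$: the bordered matrix gets a new last row $f_i^*$ (the adjoint of the new column of $F$, padded with zeros) with $f_i^*\widetilde Q_i=\alpha e_i^*$, a new last column (the new column of $G$) and a zero in the new corner; $P_{i-1}$, $\widetilde Q_i$, $L_{i-1}$ are extended by a diagonal entry $1$. Next, rows $i$ and $n_i$ are interchanged (in the accumulated row permutation, in the computed part of $L$, and in $U$), so that $\alpha$ becomes the $i$th pivot; all entries of column $i$ below this pivot are zero, so the corresponding multipliers in $L$ are zero. After step $n$, write $P_n=\begin{bmatrix} P_{1,1}&P_{1,2}\\ P_{2,1}&0\end{bmatrix}$ with $P_{1,1}$ of size $n\times n$. The matrix $G$ (whose entries do not influence the pivots) is fixed by requiring $U_{1,2}^{(n)}=0$ and $U_{2,2}^{(n)}=\alpha I$, i.e. $G=\alpha P_{2,1}^*$, and $F=F_n$. *)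

theory Defs
  imports
    "Jordan_Normal_Form.DL_Rank"
    "Jordan_Normal_Form.Column_Operations"
    "Jordan_Normal_Form.Schur_Decomposition"
begin

text \<open>
  Rows and columns are numbered from \<open>0\<close>, so step \<open>i + 1\<close> of the procedure works on the pivot
  position \<open>(i, i)\<close>, and \<open>n\<close> is the index of the first border row and of the first border column.
\<close>

definition add_col :: "'a mat \<Rightarrow> 'a vec \<Rightarrow> 'a mat" where
  "add_col A v = mat_of_cols (dim_row A) (cols A @ [v])"

definition diag_ext :: "'a :: {zero, one} mat \<Rightarrow> 'a mat" where
  "diag_ext A = four_block_mat A (0\<^sub>m (dim_row A) 1) (0\<^sub>m 1 (dim_col A)) (1\<^sub>m 1)"

definition bordered_mat :: "complex mat \<Rightarrow> complex mat \<Rightarrow> complex mat \<Rightarrow> complex mat" where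
  "bordered_mat M F G = four_block_mat M G (mat_adjoint F) (0\<^sub>m (dim_col F) (dim_col G))"

text \<open>
  Before step \<open>i + 1\<close> only the columns of \<open>L\<close> with index below \<open>i\<close> have been computed; the remaining
  ones are still columns of the identity and take no part in a row interchange.
\<close>

definition swap_computed :: "nat \<Rightarrow> nat \<Rightarrow> 'a mat \<Rightarrow> 'a mat" where
  "swap_computed i r L = mat (dim_row L) (dim_col L)
     (\<lambda>(k, j). if j < i then swaprows i r L $$ (k, j) else L $$ (k, j))"

definition store_multipliers :: "nat \<Rightarrow> 'a :: field mat \<Rightarrow> 'a mat \<Rightarrow> 'a mat" where
  "store_multipliers i U L = mat (dim_row L) (dim_col L)
     (\<lambda>(k, j). if j = i \<and> i < k then U $$ (k, i) / U $$ (i, i) else L $$ (k, j))"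

definition eliminate_below :: "nat \<Rightarrow> 'a :: field mat \<Rightarrow> 'a mat" where
  "eliminate_below i U = mat (dim_row U) (dim_col U)
     (\<lambda>(k, j). if i < k then U $$ (k, j) - U $$ (k, i) / U $$ (i, i) * U $$ (i, j)
               else U $$ (k, j))"

text \<open>
  \<open>blu_steps n \<alpha> M i F G P Q L U\<close>: the data \<open>F\<close>, \<open>G\<close>, \<open>P\<close>, \<open>Q\<close>, \<open>L\<close>, \<open>U\<close> can be reached from the
  \<open>n \<times> n\<close> matrix \<open>M\<close> by \<open>i\<close> steps. The relation is nondeterministic, so that it covers every
  pivoting strategy: a strategy may select any nonzero pivot in the search area, and it may report
  a breakdown for any column that vanishes on the search area (partial pivoting, for instance,
  reports one as soon as column \<open>i\<close> vanishes there, whatever the other columns contain).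

  The columns \<open>g\<close> appended to \<open>G\<close> are arbitrary during the run; they are fixed at its end, in
  \<open>blu_borders\<close>. After a breakdown the enlarged factor \<open>U'\<close>, before the row interchange, is the one
  for which the enlarged data again form a factorization of the bordered matrix. It is unique, as
  \<open>L\<close> is unit lower triangular: it is \<open>swapcols i c U\<close> with the new last row \<open>(0, \<dots>, \<alpha>, \<dots>, 0)\<close>
  (entry \<open>\<alpha>\<close> in column \<open>i\<close>), a new last column carrying the transformed \<open>g\<close>, and corner \<open>0\<close>.
\<close>

inductive blu_steps ::
  "nat \<Rightarrow> complex \<Rightarrow> complex mat \<Rightarrow> nat \<Rightarrow> complex mat \<Rightarrow> complex mat \<Rightarrow>
   complex mat \<Rightarrow> complex mat \<Rightarrow> complex mat \<Rightarrow> complex mat \<Rightarrow> bool"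
  for n :: nat and \<alpha> :: complex and M :: "complex mat" where
  start:
    "blu_steps n \<alpha> M 0 (0\<^sub>m n 0) (0\<^sub>m n 0) (1\<^sub>m n) (1\<^sub>m n) (1\<^sub>m n) M"
| pivot:
    "\<lbrakk> blu_steps n \<alpha> M i F G P Q L U; i < n;
       r \<in> {i..<dim_row U}; c \<in> {i..<n}; U $$ (r, c) \<noteq> 0;
       U' = swapcols i c (swaprows i r U) \<rbrakk>
     \<Longrightarrow> blu_steps n \<alpha> M (Suc i) F G
           (swaprows i r P) (swapcols i c Q)
           (store_multipliers i U' (swap_computed i r L)) (eliminate_below i U')"
| breakdown:
    "\<lbrakk> blu_steps n \<alpha> M i F G P Q L U; i < n;
       c \<in> {i..<n}; \<forall>k \<in> {i..<dim_row U}. U $$ (k, c) = 0;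
       Q' = swapcols i c Q; m = dim_col F;
       f \<in> carrier_vec n; g \<in> carrier_vec n;
       mat_of_rows (n + m) [conjugate f @\<^sub>v 0\<^sub>v m] * Q'
         = \<alpha> \<cdot>\<^sub>m mat_of_rows (n + m) [unit_vec (n + m) i];
       U' \<in> carrier_mat (n + m + 1) (n + m + 1);
       diag_ext P * bordered_mat M (add_col F f) (add_col G g) * diag_ext Q' = diag_ext L * U' \<rbrakk>
     \<Longrightarrow> blu_steps n \<alpha> M (Suc i) (add_col F f) (add_col G g)
           (swaprows i (n + m) (diag_ext P)) (diag_ext Q')
           (swap_computed i (n + m) (diag_ext L)) (swaprows i (n + m) U')"

text \<open>
  \<open>F\<close> and \<open>G\<close> are the border matrices of a complete run of the procedure. The condition on the
  last block column of \<open>U\<close> fixes \<open>G\<close>: it amounts to \<open>G = \<alpha> P\<^sub>2\<^sub>1\<^sup>*\<close>.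
\<close>

definition blu_borders ::
  "nat \<Rightarrow> complex \<Rightarrow> complex mat \<Rightarrow> complex mat \<Rightarrow> complex mat \<Rightarrow> bool" where
  "blu_borders n \<alpha> M F G \<longleftrightarrow>
     (\<exists>P Q L U U\<^sub>1\<^sub>1 U\<^sub>1\<^sub>2 U\<^sub>2\<^sub>1 U\<^sub>2\<^sub>2.
        blu_steps n \<alpha> M n F G P Q L U \<and>
        split_block U n n = (U\<^sub>1\<^sub>1, U\<^sub>1\<^sub>2, U\<^sub>2\<^sub>1, U\<^sub>2\<^sub>2) \<and>
        U\<^sub>1\<^sub>2 = 0\<^sub>m n (dim_col G) \<and> U\<^sub>2\<^sub>2 = \<alpha> \<cdot>\<^sub>m 1\<^sub>m (dim_col G))"

end

theory Submission
  imports Defs "Jordan_Normal_Form.DL_Rank_Submatrix"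
begin

text \<open>Let \<open>N\<close> be the current order of the bordered matrix. Carrying the row operations and column
  interchanges of the run over to \<open>M\<close> alone gives an \<open>N \<times> n\<close> matrix \<open>W\<close> of the same rank as \<open>M\<close>:
  a breakdown just appends a zero row to \<open>W\<close> and moves it to position \<open>i\<close>, where it is never touched
  again. On the search area \<open>W\<close> and \<open>U\<close> agree, so a breakdown at step \<open>i\<close> means that the new column
  \<open>i\<close> of \<open>W\<close> vanishes from row \<open>i\<close> on. At the end \<open>W\<close> is upper triangular; its row \<open>j\<close> is zero if step
  \<open>j\<close> was a breakdown, and its entry \<open>(j, j)\<close> is nonzero otherwise. Hence the rank of \<open>M\<close> is \<open>n\<close> minus
  the number of breakdowns, which is the number of border columns.\<close>

section \<open>Rank of products and of reduced matrices\<close>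

lemma mat_of_cols_mult:
  assumes "set vs \<subseteq> carrier_vec n" "E \<in> carrier_mat p n"
  shows "E * mat_of_cols n vs = mat_of_cols p (map ((*\<^sub>v) E) vs)"
  using assms by (intro mat_col_eqI) (auto simp: subset_code(1) nth_mem)

text \<open>A maximal independent set of columns of \<open>E * A\<close> lifts to columns of
  \<open>A\<close>. The lifts are independent, because \<open>E\<close> carries every dependency
  among them over to their images.\<close>

lemma rank_mult_le:
  fixes A :: "'a :: field mat"
  assumes E: "E \<in> carrier_mat p n" and A: "A \<in> carrier_mat n c"
  shows "vec_space.rank p (E * A) \<le> vec_space.rank n A"
proof -
  interpret Vn: vec_space "TYPE('a)" n .
  interpret Vp: vec_space "TYPE('a)" p .
  have EA: "E * A \<in> carrier_mat p c" using E A by auto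
  have "\<exists>U. finite U \<and> maximal U (\<lambda>T. T \<subseteq> set (cols (E * A)) \<and> Vp.lin_indpt T) \<and> {} \<subseteq> U"
    by (rule maximal_exists_superset[of "set (cols (E * A))"]) (auto simp: Vp.lin_dep_def)
  then obtain U where U: "maximal U (\<lambda>T. T \<subseteq> set (cols (E * A)) \<and> Vp.lin_indpt T)"
    by blast
  have cols: "cols (E * A) = map ((*\<^sub>v) E) (cols A)"
    using E A by (auto simp: cols_def)
  from U have Usub: "U \<subseteq> (*\<^sub>v) E ` set (cols A)" and Uli: "Vp.lin_indpt U"
    by (auto simp: maximal_def cols)
  \<comment> \<open>Choosing one preimage per element makes \<open>E\<close> injective on
    \<open>S\<close>. Hence \<open>S\<close> has as many elements as \<open>U\<close>, and the
    images of the distinct list \<open>ss\<close> stay distinct.\<close>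
  obtain S where S: "S \<subseteq> set (cols A)" and US: "U = (*\<^sub>v) E ` S" and inj: "inj_on ((*\<^sub>v) E) S"
    using subset_image_inj[THEN iffD1, OF Usub] by blast
  have "finite S" using S finite_subset by blast
  then obtain ss where ss: "set ss = S" "distinct ss" using finite_distinct_list by blast
  have Sc: "S \<subseteq> carrier_vec n" using S A cols_dim[of A] by auto
  define X where "X = mat_of_cols n ss"
  have X: "X \<in> carrier_mat n (length ss)" by (simp add: X_def)
  have cX: "cols X = ss" using Sc ss by (auto simp: X_def intro!: cols_mat_of_cols)
  have EX: "E * X = mat_of_cols p (map ((*\<^sub>v) E) ss)"
    unfolding X_def using Sc ss E by (intro mat_of_cols_mult) auto
  have cEX: "cols (E * X) = map ((*\<^sub>v) E) ss"
    unfolding EX using E by (intro cols_mat_of_cols) (auto simp: mult_mat_vec_def)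
  have EXc: "E * X \<in> carrier_mat p (length ss)" using E X by simp
  have "Vn.lin_indpt S"
  proof
    assume "Vn.lin_dep S"
    with X cX ss obtain v where v: "v \<in> carrier_vec (length ss)" "v \<noteq> 0\<^sub>v (length ss)"
        "X *\<^sub>v v = 0\<^sub>v n"
      using Vn.lin_depE[OF X] by metis
    have "(E * X) *\<^sub>v v = 0\<^sub>v p"
      using E X v by (auto simp: assoc_mult_mat_vec[OF E X])
    then have "Vp.lin_dep (set (cols (E * X)))"
      using v cEX ss inj by (intro Vp.lin_depI[OF EXc]) (auto simp: distinct_map)
    then show False using Uli ss US cEX by simp
  qed
  then have "card S \<le> Vn.rank A" using Vn.rank_ge_card_indpt[OF A] S by blast
  moreover have "Vp.rank (E * A) = card U" using Vp.rank_card_indpt[OF EA U] .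
  ultimately show ?thesis using card_image[OF inj] US by simp
qed

lemma rank_mult_det_nonzero:
  fixes A :: "'a :: field mat"
  assumes E: "E \<in> carrier_mat n n" and A: "A \<in> carrier_mat n c" and d: "det E \<noteq> 0"
  shows "vec_space.rank n (E * A) = vec_space.rank n A"
proof -
  obtain D where D: "D \<in> carrier_mat n n" "D * E = 1\<^sub>m n"
    using det_non_zero_imp_unit[OF E d] by (auto simp: Units_def ring_mat_def)
  have "D * (E * A) = A" using E A D assoc_mult_mat[of D n n E n A c] by simp
  then have "vec_space.rank n A \<le> vec_space.rank n (E * A)"
    using rank_mult_le[OF D(1), of "E * A" c] E A by simp
  with rank_mult_le[OF E A] show ?thesis by simp
qed

lemma rank_le_nr:
  fixes A :: "'a :: field mat"
  assumes A: "A \<in> carrier_mat n c"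
  shows "vec_space.rank n A \<le> n"
proof -
  interpret Vn: vec_space "TYPE('a)" n .
  have "\<exists>U. finite U \<and> maximal U (\<lambda>T. T \<subseteq> set (cols A) \<and> Vn.lin_indpt T) \<and> {} \<subseteq> U"
    by (rule maximal_exists_superset[of "set (cols A)"]) (auto simp: Vn.lin_dep_def)
  then obtain U where U: "maximal U (\<lambda>T. T \<subseteq> set (cols A) \<and> Vn.lin_indpt T)"
    by blast
  then have "U \<subseteq> carrier_vec n" "Vn.lin_indpt U" using A cols_dim[of A] by (auto simp: maximal_def)
  then have "card U \<le> n" using Vn.li_le_dim(2)[OF Vn.fin_dim] Vn.dim_is_n by simp
  then show ?thesis using Vn.rank_card_indpt[OF A U] by simp
qed

text \<open>\<open>A\<close> factors through dimension \<open>card I\<close>: \<open>X\<close> keeps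
  the rows with index in \<open>I\<close>, and \<open>C\<close> puts them back in place. The rank of
  \<open>X\<close> is at most its number of rows.\<close>

lemma rank_le_card_nonzero_rows:
  fixes A :: "'a :: field mat"
  assumes A: "A \<in> carrier_mat n c" and I: "I \<subseteq> {..<n}"
    and zero: "\<And>k j. k < n \<Longrightarrow> k \<notin> I \<Longrightarrow> j < c \<Longrightarrow> A $$ (k, j) = 0"
  shows "vec_space.rank n A \<le> card I"
proof -
  define js where "js = sorted_list_of_set I"
  have fin: "finite I" using I finite_subset by blast
  have js: "set js = I" "distinct js" "length js = card I" using fin by (auto simp: js_def)
  define C :: "'a mat" where "C = mat n (card I) (\<lambda>(k, a). if k = js ! a then 1 else 0)"
  define X where "X = mat (card I) c (\<lambda>(a, j). A $$ (js ! a, j))"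
  have C: "C \<in> carrier_mat n (card I)" and X: "X \<in> carrier_mat (card I) c"
    by (auto simp: C_def X_def)
  have "A = C * X"
  proof (rule eq_matI)
    fix k j assume kj: "k < dim_row (C * X)" "j < dim_col (C * X)"
    then have k: "k < n" and j: "j < c" by (auto simp: C_def X_def)
    have "(C * X) $$ (k, j) = (\<Sum>a\<in>{0..<card I}. (if k = js ! a then A $$ (js ! a, j) else 0))"
      using k j by (auto simp: C_def X_def scalar_prod_def intro!: sum.cong)
    also have "\<dots> = (\<Sum>x\<in>I. if k = x then A $$ (x, j) else 0)"
      by (intro sum.reindex_bij_betw bij_betwI')
        (use js in \<open>auto simp: nth_eq_iff_index_eq in_set_conv_nth Bex_def\<close>)
    also have "\<dots> = A $$ (k, j)" using zero[OF k _ j] fin by (auto simp: sum.delta)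
    finally show "A $$ (k, j) = (C * X) $$ (k, j)" by simp
  qed (use A in \<open>auto simp: C_def X_def\<close>)
  then have "vec_space.rank n A \<le> vec_space.rank (card I) X" using rank_mult_le[OF C X] by simp
  also have "\<dots> \<le> card I" by (rule rank_le_nr[OF X])
  finally show ?thesis .
qed

text \<open>The rank is defined from the set of columns alone, and an interchange only permutes the
  columns.\<close>

lemma rank_swapcols:
  fixes A :: "'a :: field mat"
  assumes A: "A \<in> carrier_mat n c" and i: "i < c" "l < c"
  shows "vec_space.rank n (swapcols i l A) = vec_space.rank n A"
proof -
  have "col (swapcols i l A) j = col A (if j = i then l else if j = l then i else j)" if "j < c" for j
    using that A i by (intro eq_vecI) auto
  then have "col (swapcols i l A) ` {0..<c} = col A ` (\<lambda>j. if j = i then l else if j = l then i else j) ` {0..<c}"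
    by (auto simp: image_image)
  also have "(\<lambda>j. if j = i then l else if j = l then i else j) ` {0..<c} = {0..<c}"
    using i by (auto simp: image_iff)
  finally have "set (cols (swapcols i l A)) = set (cols A)" using A by (simp add: cols_def)
  then show ?thesis by (simp add: vec_space.rank_def)
qed

text \<open>\<open>i\<close> is the number of steps done, \<open>J\<close> the set of those that were breakdowns.\<close>

definition reduced_upto :: "nat \<Rightarrow> nat set \<Rightarrow> 'a :: zero mat \<Rightarrow> bool" where
  "reduced_upto i J W \<longleftrightarrow> J \<subseteq> {..<i} \<and>
     (\<forall>j\<in>J. \<forall>c<dim_col W. W $$ (j, c) = 0) \<and>
     (\<forall>j<i. \<forall>k<dim_row W. j < k \<longrightarrow> W $$ (k, j) = 0) \<and>
     (\<forall>j<i. j \<notin> J \<longrightarrow> W $$ (j, j) \<noteq> 0)"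

text \<open>Upper bound: all nonzero rows have their index in \<open>?I\<close>, since rows in
  \<open>J\<close> vanish by assumption and rows from \<open>n\<close> on by triangularity. Lower
  bound: the minor on \<open>?I\<close> is triangular with nonzero diagonal.\<close>

lemma rank_reduced:
  fixes W :: "'a :: field mat"
  assumes W: "W \<in> carrier_mat N n" and nN: "n \<le> N" and red: "reduced_upto n J W"
  shows "vec_space.rank N W = n - card J"
proof (rule antisym)
  let ?I = "{..<n} - J"
  have J: "J \<subseteq> {..<n}" and zero: "\<And>j c. j \<in> J \<Longrightarrow> c < n \<Longrightarrow> W $$ (j, c) = 0"
    and tri: "\<And>j k. j < n \<Longrightarrow> k < N \<Longrightarrow> j < k \<Longrightarrow> W $$ (k, j) = 0"
    and diag: "\<And>j. j \<in> ?I \<Longrightarrow> W $$ (j, j) \<noteq> 0"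
    using red W by (auto simp: reduced_upto_def)
  have cI: "card ?I = n - card J" using J by (simp add: card_Diff_subset finite_subset)
  have "vec_space.rank N W \<le> card ?I"
    using nN zero tri by (intro rank_le_card_nonzero_rows[OF W]) auto
  then show "vec_space.rank N W \<le> n - card J" using cI by simp
  \<comment> \<open>\<open>submatrix\<close> takes only those selected indices that lie below the
    dimension; by \<open>n \<le> N\<close> this is all of \<open>?I\<close>, for rows as well as
    columns.\<close>
  have rows: "{i. i < N \<and> i \<in> ?I} = ?I" and cols: "{j. j < n \<and> j \<in> ?I} = ?I" using nN by auto
  let ?S = "submatrix W ?I ?I"
  have S: "?S \<in> carrier_mat (card ?I) (card ?I)"
    using W rows cols by (intro carrier_matI) (simp_all only: dim_submatrix carrier_matD)
  have ent: "?S $$ (a, b) = W $$ (pick ?I a, pick ?I b)" if "a < card ?I" "b < card ?I" for a b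
    using that W rows cols by (intro submatrix_index) (simp_all only: carrier_matD)
  have mem: "pick ?I a \<in> ?I" if "a < card ?I" for a
    using that pick_in_set_le[of a ?I] by blast
  have "upper_triangular ?S"
  proof (rule upper_triangularI)
    fix a b assume "b < a" "a < dim_row ?S"
    then have ab: "b < a" "a < card ?I" "b < card ?I" using S by auto
    \<comment> \<open>\<open>pick\<close> enumerates \<open>?I\<close> increasingly, so entries
      below the diagonal of the submatrix come from below the diagonal of \<open>W\<close>.\<close>
    then have "pick ?I b < pick ?I a" by (intro pick_mono_le) auto
    then show "?S $$ (a, b) = 0"
      using ent ab mem[of a] mem[of b] nN by (simp add: tri)
  qed
  then have "det ?S = prod_list (diag_mat ?S)" using S by (rule det_upper_triangular)
  moreover have "0 \<notin> set (diag_mat ?S)"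
    using S ent mem diag by (auto simp: diag_mat_def)
  ultimately have "det ?S \<noteq> 0" by (simp add: prod_list_zero_iff)
  from vec_space.rank_gt_minor[OF W this] show "n - card J \<le> vec_space.rank N W"
    using cI by (simp only: cols)
qed

section \<open>Row interchanges and elimination in the triangular factors\<close>

definition partial_lower :: "nat \<Rightarrow> nat \<Rightarrow> 'a :: {zero, one} mat \<Rightarrow> bool" where
  "partial_lower N i L \<longleftrightarrow> L \<in> carrier_mat N N \<and>
     (\<forall>k<N. L $$ (k, k) = 1) \<and> (\<forall>k<N. \<forall>j<N. k < j \<longrightarrow> L $$ (k, j) = 0) \<and>
     (\<forall>k<N. \<forall>j<N. i \<le> j \<longrightarrow> L $$ (k, j) = (if k = j then 1 else 0))"

lemma partial_lower_one: "partial_lower N i (1\<^sub>m N)"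
  by (auto simp: partial_lower_def)

lemma det_partial_lower:
  fixes L :: "'a :: field mat"
  assumes "partial_lower N i L"
  shows "det L = 1"
proof -
  have L: "L \<in> carrier_mat N N" and z: "\<And>k j. k < j \<Longrightarrow> j < N \<Longrightarrow> L $$ (k, j) = 0"
    and d: "\<And>k. k < N \<Longrightarrow> L $$ (k, k) = 1"
    using assms by (auto simp: partial_lower_def)
  have "det L = prod_list (diag_mat L)" using z L by (rule det_lower_triangular)
  also have "diag_mat L = map (\<lambda>_. 1) [0..<N]" using L d by (auto simp: diag_mat_def)
  finally show ?thesis by (simp add: map_replicate_const prod_list_power)
qed

text \<open>Invertibility of \<open>L\<close> makes the right factor of a factorization unique; this
  later pins down the implicitly given factor of a breakdown.\<close>

lemma partial_lower_mult_cancel: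
  fixes L :: "'a :: field mat"
  assumes L: "partial_lower N i L" and X: "X \<in> carrier_mat N c" and Y: "Y \<in> carrier_mat N c"
    and eq: "L * X = L * Y"
  shows "X = Y"
proof -
  have Lc: "L \<in> carrier_mat N N" using L by (simp add: partial_lower_def)
  obtain D where D: "D \<in> carrier_mat N N" "D * L = 1\<^sub>m N"
    using det_non_zero_imp_unit[OF Lc] det_partial_lower[OF L] by (auto simp: Units_def ring_mat_def)
  have "X = D * (L * X)" using Lc D X assoc_mult_mat[of D N N L N X c] by simp
  also have "\<dots> = Y" unfolding eq using Lc D Y assoc_mult_mat[of D N N L N Y c] by simp
  finally show ?thesis .
qed

lemma partial_lower_swap_computed:
  assumes "partial_lower N i L" "i \<le> r" "r < N"
  shows "partial_lower N i (swap_computed i r L)"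
  using assms by (auto simp: partial_lower_def swap_computed_def)

lemma partial_lower_store_multipliers:
  assumes "partial_lower N i L" "U \<in> carrier_mat N c"
  shows "partial_lower N (Suc i) (store_multipliers i U L)"
  using assms by (auto simp: partial_lower_def store_multipliers_def)

lemma partial_lower_mono: "partial_lower N i L \<Longrightarrow> i \<le> j \<Longrightarrow> partial_lower N j L"
  by (auto simp: partial_lower_def)

lemma diag_ext_index:
  assumes "A \<in> carrier_mat N N" "k < Suc N" "j < Suc N"
  shows "diag_ext A $$ (k, j) = (if k < N \<and> j < N then A $$ (k, j) else if k = j then 1 else 0)"
  using assms by (auto simp: diag_ext_def)

lemma diag_ext_carrier: "A \<in> carrier_mat N N \<Longrightarrow> diag_ext A \<in> carrier_mat (Suc N) (Suc N)"
  by (auto simp: diag_ext_def)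

lemma partial_lower_diag_ext:
  assumes "partial_lower N i L"
  shows "partial_lower (Suc N) i (diag_ext L)"
proof -
  have L: "L \<in> carrier_mat N N" using assms by (simp add: partial_lower_def)
  show ?thesis using assms unfolding partial_lower_def
    by (simp add: diag_ext_index[OF L] diag_ext_carrier[OF L])
qed

text \<open>The columns of \<open>L\<close> from \<open>i\<close> on are identity columns and
  \<open>i \<le> r\<close>. Interchanging rows in the computed part only is therefore the same as
  conjugating \<open>L\<close> by the transposition \<open>?S\<close>, and the inner
  \<open>?S\<close> cancels against the one in \<open>swaprows i r U\<close>.\<close>

lemma swap_computed_mult_swaprows:
  fixes L U :: "'a :: field mat"
  assumes L: "partial_lower N i L" and U: "U \<in> carrier_mat N c" and r: "i \<le> r" "r < N"
  shows "swap_computed i r L * swaprows i r U = swaprows i r (L * U)"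
proof -
  have i: "i < N" using r by simp
  have Lc: "L \<in> carrier_mat N N" using L by (simp add: partial_lower_def)
  let ?S = "swaprows_mat N i r :: 'a mat"
  have S: "?S \<in> carrier_mat N N" by simp
  have "swap_computed i r L = swapcols i r (swaprows i r L)"
    using L r by (intro eq_matI) (auto simp: partial_lower_def swap_computed_def)
  also have "\<dots> = ?S * L * ?S"
    using Lc i r S by (simp only: swaprows_mat[of L N N] swapcols_mat[of "?S * L" N N] mult_carrier_mat)
  finally have "swap_computed i r L * swaprows i r U = ?S * L * ?S * (?S * U)"
    using U i r by (simp add: swaprows_mat[of _ N c])
  also have "\<dots> = ?S * L * (?S * (?S * U))"
    using Lc U S by (intro assoc_mult_mat[of _ N N _ N _ c]) auto
  also have "?S * (?S * U) = ?S * ?S * U"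
    using U S by (intro assoc_mult_mat[of _ N N _ N _ c, symmetric]) auto
  also have "\<dots> = U" using U i r by (simp add: swaprows_mat_inv)
  also have "?S * L * U = swaprows i r (L * U)"
    using Lc U i r S assoc_mult_mat[of ?S N N L N U c] by (simp add: swaprows_mat[of _ N c])
  finally show ?thesis .
qed

text \<open>The new factors are \<open>L + Z\<close> and \<open>U - Z * U\<close>, where
  \<open>Z\<close> holds the multipliers in column \<open>i\<close> below the diagonal. Since
  \<open>L * Z = Z\<close> and \<open>Z * (Z * U)\<close> vanishes, the correction terms
  cancel.\<close>

lemma store_multipliers_mult_eliminate_below:
  fixes L U :: "'a :: field mat"
  assumes L: "partial_lower N i L" and U: "U \<in> carrier_mat N c" and i: "i < N"
  shows "store_multipliers i U L * eliminate_below i U = L * U"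
proof -
  have Lc: "L \<in> carrier_mat N N" using L by (simp add: partial_lower_def)
  define z where "z k = (if i < k then U $$ (k, i) / U $$ (i, i) else 0)" for k
  define Z where "Z = mat N N (\<lambda>(k, j). if j = i then z k else 0)"
  have Z: "Z \<in> carrier_mat N N" by (simp add: Z_def)
  have Zm: "(Z * X) $$ (k, j) = z k * X $$ (i, j)" if "X \<in> carrier_mat N d" "k < N" "j < d" for X k j d
  proof -
    have "(Z * X) $$ (k, j) = (\<Sum>l\<in>{0..<N}. if l = i then z k * X $$ (l, j) else 0)"
      using that by (simp add: Z_def scalar_prod_def if_distrib[of "\<lambda>x. x * _"] cong: if_cong)
    then show ?thesis using i by (simp only: sum.delta finite_atLeastLessThan) simp
  qed
  have st: "store_multipliers i U L = L + Z"
    using L U i by (intro eq_matI) (auto simp: store_multipliers_def Z_def z_def partial_lower_def)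
  have ZU: "Z * U \<in> carrier_mat N c" using Z U by simp
  have el: "eliminate_below i U = U - Z * U"
    using U Z by (intro eq_matI) (auto simp: eliminate_below_def Zm z_def simp del: index_mult_mat(1))
  \<comment> \<open>Row \<open>i\<close> of \<open>Z * U\<close> vanishes because
    \<open>z i = 0\<close>, and left multiplication by \<open>Z\<close> reads only that row.\<close>
  have ZZ: "Z * (Z * U) = 0\<^sub>m N c"
    using U Z i by (intro eq_matI) (auto simp: Zm[OF ZU] Zm[OF U] z_def simp del: index_mult_mat(1))
  have LZ: "L * Z = Z"
  proof (rule eq_matI)
    fix k j assume "k < dim_row Z" "j < dim_col Z"
    then have kj: "k < N" "j < N" by (auto simp: Z_def)
    have "(L * Z) $$ (k, j) = (\<Sum>l\<in>{0..<N}. L $$ (k, l) * Z $$ (l, j))"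
      using kj Lc Z by (auto simp: scalar_prod_def intro!: sum.cong)
    \<comment> \<open>\<open>Z $$ (l, j)\<close> can be nonzero only for \<open>l > i\<close>, and
      there column \<open>l\<close> of \<open>L\<close> is an identity column.\<close>
    also have "\<dots> = (\<Sum>l\<in>{0..<N}. if l = k then Z $$ (k, j) else 0)"
      using L kj by (intro sum.cong) (auto simp: partial_lower_def Z_def z_def)
    finally show "(L * Z) $$ (k, j) = Z $$ (k, j)" using kj by simp
  qed (use Lc Z in auto)
  have "store_multipliers i U L * eliminate_below i U
      = (L * U - L * (Z * U)) + (Z * U - Z * (Z * U))"
  proof -
    have "(L + Z) * (U - Z * U) = L * (U - Z * U) + Z * (U - Z * U)"
      using Lc Z U ZU by (intro add_mult_distrib_mat[of _ N N _ _ c]) auto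
    also have "L * (U - Z * U) = L * U - L * (Z * U)"
      using Lc U ZU by (intro mult_minus_distrib_mat[of _ N N _ c])
    also have "Z * (U - Z * U) = Z * U - Z * (Z * U)"
      using Z U ZU by (intro mult_minus_distrib_mat[of _ N N _ c])
    finally show ?thesis unfolding st el .
  qed
  also have "L * (Z * U) = Z * U"
    using Lc Z U LZ assoc_mult_mat[of L N N Z N U c] by simp
  also have "(L * U - Z * U) + (Z * U - Z * (Z * U)) = L * U"
    unfolding ZZ using Lc U Z by (intro eq_matI) (auto simp del: index_mult_mat(1))
  finally show ?thesis .
qed

section \<open>Rank under row operations and under an added zero row\<close>

lemma rank_eliminate_below:
  fixes W :: "'a :: field mat"
  assumes W: "W \<in> carrier_mat N c" and i: "i < N"
  shows "vec_space.rank N (eliminate_below i W) = vec_space.rank N W"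
proof -
  let ?E = "store_multipliers i W (1\<^sub>m N)"
  have E: "partial_lower N (Suc i) ?E" by (rule partial_lower_store_multipliers[OF partial_lower_one W])
  have "eliminate_below i W \<in> carrier_mat N c" using W by (auto simp: eliminate_below_def)
  \<comment> \<open>With the identity in the place of \<open>L\<close>, the multiplier matrix, of
    determinant 1, undoes the elimination.\<close>
  moreover have "?E * eliminate_below i W = W"
    using store_multipliers_mult_eliminate_below[OF partial_lower_one W i] W by simp
  ultimately show ?thesis
    using rank_mult_det_nonzero[of ?E N "eliminate_below i W" c] E det_partial_lower[OF E]
    by (simp add: partial_lower_def)
qed

lemma rank_swaprows:
  fixes W :: "'a :: field mat"
  assumes W: "W \<in> carrier_mat N c" and i: "i < N" "r < N"
  shows "vec_space.rank N (swaprows i r W) = vec_space.rank N W"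
proof -
  have "swaprows_mat N i r * swaprows_mat N i r = (1\<^sub>m N :: 'a mat)"
    using i by (rule swaprows_mat_inv)
  then have "det (swaprows_mat N i r :: 'a mat) \<noteq> 0"
    using det_mult[of "swaprows_mat N i r :: 'a mat" N "swaprows_mat N i r"] by auto
  then show ?thesis
    using rank_mult_det_nonzero[OF _ W, of "swaprows_mat N i r"] W i
    by (simp add: swaprows_mat[of _ N c])
qed

definition add_zero_row :: "'a :: zero mat \<Rightarrow> 'a mat" where
  "add_zero_row W = mat (Suc (dim_row W)) (dim_col W)
     (\<lambda>(k, j). if k < dim_row W then W $$ (k, j) else 0)"

text \<open>Each of the two matrices arises from the other by a left multiplication:
  \<open>?E\<close> appends a zero coordinate and \<open>?D\<close> drops the last one.\<close>

lemma rank_add_zero_row: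
  fixes W :: "'a :: field mat"
  assumes W: "W \<in> carrier_mat N c"
  shows "vec_space.rank (Suc N) (add_zero_row W) = vec_space.rank N W"
proof (rule antisym)
  let ?W = "add_zero_row W"
  let ?E = "mat (Suc N) N (\<lambda>(k, j). if k = j then 1 else 0) :: 'a mat"
  let ?D = "mat N (Suc N) (\<lambda>(k, j). if k = j then 1 else 0) :: 'a mat"
  have W': "?W \<in> carrier_mat (Suc N) c" using W by (auto simp: add_zero_row_def)
  have "?E * W = ?W"
    using W by (intro eq_matI) (auto simp: add_zero_row_def scalar_prod_def if_distrib[of "\<lambda>x. x * _"] cong: if_cong)
  then show "vec_space.rank (Suc N) ?W \<le> vec_space.rank N W"
    using rank_mult_le[of ?E "Suc N" N W c] W by simp
  have "?D * ?W = W"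
    using W by (intro eq_matI) (auto simp: add_zero_row_def scalar_prod_def if_distrib[of "\<lambda>x. x * _"] cong: if_cong)
  then show "vec_space.rank N W \<le> vec_space.rank (Suc N) ?W"
    using rank_mult_le[of ?D N "Suc N" ?W c] W' by simp
qed

section \<open>Effect of one step on the reduced form\<close>

lemma reduced_upto_pivot:
  fixes W :: "'a :: field mat"
  assumes W: "W \<in> carrier_mat N n" and red: "reduced_upto i J W" and nN: "n \<le> N"
    and r: "i \<le> r" "r < N" and c: "i \<le> c" "c < n" and nz: "W $$ (r, c) \<noteq> 0"
  shows "reduced_upto (Suc i) J (eliminate_below i (swapcols i c (swaprows i r W)))"
proof -
  have J: "J \<subseteq> {..<i}" and zero: "\<And>j d. j \<in> J \<Longrightarrow> d < n \<Longrightarrow> W $$ (j, d) = 0"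
    and tri: "\<And>j k. j < i \<Longrightarrow> k < N \<Longrightarrow> j < k \<Longrightarrow> W $$ (k, j) = 0"
    and diag: "\<And>j. j < i \<Longrightarrow> j \<notin> J \<Longrightarrow> W $$ (j, j) \<noteq> 0"
    using red W by (auto simp: reduced_upto_def)
  define V where "V = swapcols i c (swaprows i r W)"
  have V: "V \<in> carrier_mat N n" using W by (simp add: V_def)
  \<comment> \<open>Both interchanges move only indices from \<open>i\<close> on, so what was
    reached in rows and columns before \<open>i\<close> survives, while position
    \<open>(i, i)\<close> receives the pivot \<open>W $$ (r, c)\<close>.\<close>
  have ent: "V $$ (k, j) = W $$ (if k = i then r else if k = r then i else k,
      if j = i then c else if j = c then i else j)" if "k < N" "j < n" for k j
    using that W r c nN by (auto simp: V_def)
  have Vzero: "V $$ (j, d) = 0" if "j \<in> J" "d < n" for j d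
  proof -
    have "j < i" using J that by auto
    then show ?thesis using that r c nN by (simp add: ent zero)
  qed
  have Vtri: "V $$ (k, j) = 0" if "j < i" "k < N" "j < k" for j k
    using that r c nN by (simp add: ent tri)
  have Vdiag: "V $$ (j, j) \<noteq> 0" if "j < Suc i" "j \<notin> J" for j
    using that r c nN nz by (cases "j = i") (simp_all add: ent diag)
  have el: "eliminate_below i V $$ (k, j) =
      (if i < k then V $$ (k, j) - V $$ (k, i) / V $$ (i, i) * V $$ (i, j) else V $$ (k, j))"
    if "k < N" "j < n" for k j
    using that V by (simp add: eliminate_below_def)
  have "eliminate_below i V $$ (j, d) = 0" if "j \<in> J" "d < n" for j d
  proof -
    have "j < i" using J that by auto
    then show ?thesis using that r c nN by (simp add: el Vzero)
  qed
  \<comment> \<open>Column \<open>i\<close> is cleared by the nonzero pivot. In an earlier column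
    the entries in row \<open>i\<close> and below are already zero, so the elimination keeps them
    zero.\<close>
  moreover have "eliminate_below i V $$ (k, j) = 0" if "j < Suc i" "k < N" "j < k" for j k
  proof (cases "j = i")
    case True
    moreover have "V $$ (i, i) \<noteq> 0" using Vdiag[of i] J by auto
    ultimately show ?thesis using that r c nN by (simp add: el)
  next
    case False
    then show ?thesis using that r c nN by (simp add: el Vtri)
  qed
  moreover have "eliminate_below i V $$ (j, j) \<noteq> 0" if "j < Suc i" "j \<notin> J" for j
    using that r c nN Vdiag[OF that] by (simp add: el)
  moreover have "eliminate_below i V \<in> carrier_mat N n" using V by (simp add: eliminate_below_def)
  moreover have "J \<subseteq> {..<Suc i}" using J by auto
  ultimately show ?thesis unfolding V_def[symmetric] by (simp add: reduced_upto_def)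
qed

text \<open>The interchange puts the appended zero row into position \<open>i\<close> and the old
  row \<open>i\<close> last. As column \<open>c\<close> vanishes from row \<open>i\<close> on, the
  new column \<open>i\<close> is zero below position \<open>i\<close>; the zero row \<open>i\<close>
  is recorded in \<open>insert i J\<close>.\<close>

lemma reduced_upto_breakdown:
  fixes W :: "'a :: field mat"
  assumes W: "W \<in> carrier_mat N n" and red: "reduced_upto i J W" and nN: "n \<le> N"
    and c: "i \<le> c" "c < n" and z: "\<And>k. i \<le> k \<Longrightarrow> k < N \<Longrightarrow> W $$ (k, c) = 0"
  shows "reduced_upto (Suc i) (insert i J) (swaprows i N (add_zero_row (swapcols i c W)))"
proof -
  have J: "J \<subseteq> {..<i}" and zero: "\<And>j d. j \<in> J \<Longrightarrow> d < n \<Longrightarrow> W $$ (j, d) = 0"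
    and tri: "\<And>j k. j < i \<Longrightarrow> k < N \<Longrightarrow> j < k \<Longrightarrow> W $$ (k, j) = 0"
    and diag: "\<And>j. j < i \<Longrightarrow> j \<notin> J \<Longrightarrow> W $$ (j, j) \<noteq> 0"
    using red W by (auto simp: reduced_upto_def)
  let ?V = "swaprows i N (add_zero_row (swapcols i c W))"
  have V: "?V \<in> carrier_mat (Suc N) n" using W by (simp add: add_zero_row_def)
  have ent: "?V $$ (k, j) = (if k = i then 0 else
      W $$ (if k = N then i else k, if j = i then c else if j = c then i else j))"
    if "k < Suc N" "j < n" for k j
    using that W c nN by (auto simp: add_zero_row_def)
  have "?V $$ (j, d) = 0" if "j \<in> insert i J" "d < n" for j d
  proof (cases "j = i")
    case False
    then have "j \<in> J" "j < i" using J that by auto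
    then show ?thesis using that c nN by (simp add: ent zero)
  qed (use that c nN in \<open>simp add: ent\<close>)
  moreover have "?V $$ (k, j) = 0" if "j < Suc i" "k < Suc N" "j < k" for j k
    using that c nN by (cases "j = i") (simp_all add: ent z tri)
  moreover have "?V $$ (j, j) \<noteq> 0" if "j < Suc i" "j \<notin> insert i J" for j
    using that c nN by (simp add: ent diag)
  moreover have "insert i J \<subseteq> {..<Suc i}" using J by auto
  ultimately show ?thesis using V by (simp add: reduced_upto_def)
qed

section \<open>Leading blocks and bordered matrices\<close>

definition upper_left :: "nat \<Rightarrow> 'a mat \<Rightarrow> 'a mat" where
  "upper_left N A = mat N N (\<lambda>(k, j). A $$ (k, j))"

text \<open>In its first \<open>N\<close> rows \<open>diag_ext A\<close> has a zero last column, so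
  the last term of each product sum drops out.\<close>

lemma upper_left_diag_ext_mult:
  fixes A X :: "'a :: comm_semiring_1 mat"
  assumes A: "A \<in> carrier_mat N N" and X: "X \<in> carrier_mat (Suc N) (Suc N)"
  shows "upper_left N (diag_ext A * X) = A * upper_left N X"
proof (rule eq_matI)
  fix k j assume "k < dim_row (A * upper_left N X)" "j < dim_col (A * upper_left N X)"
  then have kj: "k < N" "j < N" using A by (auto simp: upper_left_def)
  have "upper_left N (diag_ext A * X) $$ (k, j) = (\<Sum>l = 0..<Suc N. diag_ext A $$ (k, l) * X $$ (l, j))"
    using kj X carrier_matD[OF diag_ext_carrier[OF A]] by (simp add: upper_left_def scalar_prod_def)
  also have "\<dots> = (\<Sum>l = 0..<N. A $$ (k, l) * X $$ (l, j))"
    using kj by (simp add: diag_ext_index[OF A])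
  also have "\<dots> = (A * upper_left N X) $$ (k, j)"
    using kj A by (simp add: upper_left_def scalar_prod_def)
  finally show "upper_left N (diag_ext A * X) $$ (k, j) = (A * upper_left N X) $$ (k, j)" .
qed (use A in \<open>simp_all add: upper_left_def\<close>)

lemma upper_left_mult_diag_ext:
  fixes A X :: "'a :: comm_semiring_1 mat"
  assumes A: "A \<in> carrier_mat N N" and X: "X \<in> carrier_mat (Suc N) (Suc N)"
  shows "upper_left N (X * diag_ext A) = upper_left N X * A"
proof (rule eq_matI)
  fix k j assume "k < dim_row (upper_left N X * A)" "j < dim_col (upper_left N X * A)"
  then have kj: "k < N" "j < N" using A by (auto simp: upper_left_def)
  have "upper_left N (X * diag_ext A) $$ (k, j) = (\<Sum>l = 0..<Suc N. X $$ (k, l) * diag_ext A $$ (l, j))"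
    using kj X carrier_matD[OF diag_ext_carrier[OF A]] by (simp add: upper_left_def scalar_prod_def)
  also have "\<dots> = (\<Sum>l = 0..<N. X $$ (k, l) * A $$ (l, j))"
    using kj by (simp add: diag_ext_index[OF A])
  also have "\<dots> = (upper_left N X * A) $$ (k, j)"
    using kj A by (simp add: upper_left_def scalar_prod_def)
  finally show "upper_left N (X * diag_ext A) $$ (k, j) = (upper_left N X * A) $$ (k, j)" .
qed (use A in \<open>simp_all add: upper_left_def\<close>)

lemma add_col_carrier:
  "A \<in> carrier_mat n m \<Longrightarrow> add_col A v \<in> carrier_mat n (Suc m)"
  by (auto simp: add_col_def)

lemma add_col_index:
  assumes "A \<in> carrier_mat n m" "k < n" "j < m"
  shows "add_col A v $$ (k, j) = A $$ (k, j)"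
  using assms by (auto simp: add_col_def mat_of_cols_index nth_append)

lemma mat_adjoint_carrier:
  "F \<in> carrier_mat n m \<Longrightarrow> mat_adjoint F \<in> carrier_mat m n"
  by (auto simp: mat_adjoint_def)

lemma mat_adjoint_index:
  assumes "F \<in> carrier_mat n m" "k < m" "j < n"
  shows "mat_adjoint F $$ (k, j) = conjugate (F $$ (j, k))"
  using assms by (auto simp: mat_adjoint_def mat_of_rows_index)

lemma bordered_mat_carrier:
  "M \<in> carrier_mat n n \<Longrightarrow> F \<in> carrier_mat n m \<Longrightarrow> G \<in> carrier_mat n m \<Longrightarrow>
    bordered_mat M F G \<in> carrier_mat (n + m) (n + m)"
  by (auto simp: bordered_mat_def)

lemma bordered_mat_index:
  assumes "M \<in> carrier_mat n n" "F \<in> carrier_mat n m" "G \<in> carrier_mat n m" "k < n + m" "j < n + m"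
  shows "bordered_mat M F G $$ (k, j) =
    (if k < n then if j < n then M $$ (k, j) else G $$ (k, j - n)
     else if j < n then conjugate (F $$ (j, k - n)) else 0)"
proof -
  note adj = carrier_matD[OF mat_adjoint_carrier[OF assms(2)]]
  show ?thesis
    using assms unfolding bordered_mat_def
    by (simp add: adj index_mat_four_block mat_adjoint_index[OF assms(2)])
qed

lemma upper_left_bordered_mat_add_col:
  assumes M: "M \<in> carrier_mat n n" and F: "F \<in> carrier_mat n m" and G: "G \<in> carrier_mat n m"
  shows "upper_left (n + m) (bordered_mat M (add_col F f) (add_col G g)) = bordered_mat M F G"
proof (rule eq_matI)
  note B = bordered_mat_carrier[OF M F G]
  note F' = add_col_carrier[OF F, of f] and G' = add_col_carrier[OF G, of g]
  show "dim_row (upper_left (n + m) (bordered_mat M (add_col F f) (add_col G g)))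
      = dim_row (bordered_mat M F G)"
    "dim_col (upper_left (n + m) (bordered_mat M (add_col F f) (add_col G g)))
      = dim_col (bordered_mat M F G)"
    using B by (auto simp: upper_left_def)
  fix k j assume "k < dim_row (bordered_mat M F G)" "j < dim_col (bordered_mat M F G)"
  then have kj: "k < n + m" "j < n + m" using B by auto
  then show "upper_left (n + m) (bordered_mat M (add_col F f) (add_col G g)) $$ (k, j)
      = bordered_mat M F G $$ (k, j)"
    by (simp add: upper_left_def bordered_mat_index[OF M F' G'] bordered_mat_index[OF M F G]
        add_col_index[OF F] add_col_index[OF G])
qed

section \<open>Invariants of the procedure\<close>

lemma eliminate_below_index:
  assumes "A \<in> carrier_mat N m" "k < N" "j < m"
  shows "eliminate_below i A $$ (k, j) =
    (if i < k then A $$ (k, j) - A $$ (k, i) / A $$ (i, i) * A $$ (i, j) else A $$ (k, j))"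
  using assms by (simp add: eliminate_below_def)

text \<open>A pivot step multiplies by a transposition on either side, followed by an elimination
  that keeps the product of the factors. In a breakdown the enlarged factorization is a premise of
  the rule, and only the row interchange is left to account for.\<close>

lemma blu_steps_factorization:
  assumes "blu_steps n \<alpha> M i F G P Q L U" and M: "M \<in> carrier_mat n n"
  shows "\<exists>m. F \<in> carrier_mat n m \<and> G \<in> carrier_mat n m \<and>
    P \<in> carrier_mat (n + m) (n + m) \<and> Q \<in> carrier_mat (n + m) (n + m) \<and>
    U \<in> carrier_mat (n + m) (n + m) \<and> partial_lower (n + m) i L \<and>
    P * bordered_mat M F G * Q = L * U"
  using assms(1)
proof induction
  case start
  have "bordered_mat M (0\<^sub>m n 0) (0\<^sub>m n 0) = M"
    using M bordered_mat_carrier[OF M, of "0\<^sub>m n 0" 0 "0\<^sub>m n 0"]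
    by (intro eq_matI) (simp_all add: bordered_mat_index[OF M, of "0\<^sub>m n 0" 0 "0\<^sub>m n 0"])
  then show ?case using M partial_lower_one[of n 0] by (intro exI[of _ 0]) auto
next
  case (pivot i F G P Q L U r c U')
  then obtain m where F: "F \<in> carrier_mat n m" and G: "G \<in> carrier_mat n m"
    and P: "P \<in> carrier_mat (n + m) (n + m)" and Q: "Q \<in> carrier_mat (n + m) (n + m)"
    and U: "U \<in> carrier_mat (n + m) (n + m)" and L: "partial_lower (n + m) i L"
    and fac: "P * bordered_mat M F G * Q = L * U"
    by blast
  let ?N = "n + m" and ?B = "bordered_mat M F G"
  let ?R = "swaprows_mat ?N i r :: complex mat" and ?C = "swaprows_mat ?N i c :: complex mat"
  have i: "i < ?N" "i \<le> r" "r < ?N" "i \<le> c" "c < ?N" using pivot.hyps U by auto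
  have B: "?B \<in> carrier_mat ?N ?N" using bordered_mat_carrier[OF M F G] .
  have Lc: "L \<in> carrier_mat ?N ?N" using L by (simp add: partial_lower_def)
  have L1: "partial_lower ?N i (swap_computed i r L)" using partial_lower_swap_computed[OF L] i by simp
  have L1c: "swap_computed i r L \<in> carrier_mat ?N ?N" using L1 by (simp add: partial_lower_def)
  have RC: "?R \<in> carrier_mat ?N ?N" "?C \<in> carrier_mat ?N ?N" by auto
  have U': "U' \<in> carrier_mat ?N ?N" using U pivot.hyps by simp
  have Us: "swaprows i r U \<in> carrier_mat ?N ?N" using U by simp
  have U'C: "U' = swaprows i r U * ?C"
    using pivot.hyps(6) swapcols_mat[OF Us i(1) i(5)] by simp
  have "swaprows i r P * ?B * swapcols i c Q = (?R * P) * ?B * (Q * ?C)"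
    using P Q i by (simp only: swaprows_mat[of P ?N ?N] swapcols_mat[of Q ?N ?N])
  also have "\<dots> = ?R * (P * ?B * Q) * ?C"
    using P Q B RC by (simp add: assoc_mult_mat[of _ ?N ?N _ ?N _ ?N])
  also have "?R * (P * ?B * Q) = swaprows i r (L * U)"
    unfolding fac using Lc U i by (intro swaprows_mat[symmetric, of _ _ ?N]) auto
  also have "\<dots> = swap_computed i r L * swaprows i r U"
    using swap_computed_mult_swaprows[OF L U] i by simp
  also have "\<dots> * ?C = swap_computed i r L * U'"
    unfolding U'C using L1c Us RC by (intro assoc_mult_mat[of _ ?N ?N _ ?N _ ?N])
  also have "\<dots> = store_multipliers i U' (swap_computed i r L) * eliminate_below i U'"
    using store_multipliers_mult_eliminate_below[OF L1 U' i(1)] by simp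
  finally have "swaprows i r P * ?B * swapcols i c Q
      = store_multipliers i U' (swap_computed i r L) * eliminate_below i U'" .
  moreover have "partial_lower ?N (Suc i) (store_multipliers i U' (swap_computed i r L))"
    by (rule partial_lower_store_multipliers[OF L1 U'])
  moreover have "eliminate_below i U' \<in> carrier_mat ?N ?N"
    using U' by (simp add: eliminate_below_def)
  ultimately show ?case using F G P Q by (intro exI[of _ m]) simp
next
  case (breakdown i F G P Q L U c Q' m f g U')
  then have F: "F \<in> carrier_mat n m" and G: "G \<in> carrier_mat n m"
    and P: "P \<in> carrier_mat (n + m) (n + m)" and Q: "Q \<in> carrier_mat (n + m) (n + m)"
    and U: "U \<in> carrier_mat (n + m) (n + m)" and L: "partial_lower (n + m) i L"
    by auto
  let ?N = "n + m" and ?B = "bordered_mat M (add_col F f) (add_col G g)"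
  let ?R = "swaprows_mat (Suc ?N) i ?N :: complex mat"
  have i: "i < ?N" using breakdown.hyps by simp
  have Q': "Q' \<in> carrier_mat ?N ?N" using Q breakdown.hyps by simp
  have F': "add_col F f \<in> carrier_mat n (Suc m)" and G': "add_col G g \<in> carrier_mat n (Suc m)"
    using F G by (auto intro: add_col_carrier)
  have B: "?B \<in> carrier_mat (Suc ?N) (Suc ?N)" using bordered_mat_carrier[OF M F' G'] by simp
  have U': "U' \<in> carrier_mat (Suc ?N) (Suc ?N)" using breakdown.hyps by simp
  note Pd = diag_ext_carrier[OF P] and Qd = diag_ext_carrier[OF Q']
  have Ld: "partial_lower (Suc ?N) i (diag_ext L)" by (rule partial_lower_diag_ext[OF L])
  have R: "?R \<in> carrier_mat (Suc ?N) (Suc ?N)" by simp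
  have "swaprows i ?N (diag_ext P) * ?B * diag_ext Q' = (?R * diag_ext P) * ?B * diag_ext Q'"
    using Pd i by (simp add: swaprows_mat[of _ "Suc ?N" "Suc ?N"])
  also have "\<dots> = ?R * (diag_ext P * ?B * diag_ext Q')"
    using Pd Qd B R by (simp add: assoc_mult_mat[of _ "Suc ?N" "Suc ?N" _ "Suc ?N" _ "Suc ?N"])
  also have "\<dots> = swaprows i ?N (diag_ext L * U')"
    unfolding breakdown.hyps(11) using Ld U' i
    by (intro swaprows_mat[symmetric, of _ _ "Suc ?N"]) (auto simp: partial_lower_def)
  also have "\<dots> = swap_computed i ?N (diag_ext L) * swaprows i ?N U'"
    using swap_computed_mult_swaprows[OF Ld U', of ?N] i by simp
  finally have "swaprows i ?N (diag_ext P) * ?B * diag_ext Q'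
      = swap_computed i ?N (diag_ext L) * swaprows i ?N U'" .
  \<comment> \<open>The multipliers of a breakdown are all zero, so column \<open>i\<close> stays an
    identity column.\<close>
  moreover have "partial_lower (Suc ?N) (Suc i) (swap_computed i ?N (diag_ext L))"
    using partial_lower_mono[OF partial_lower_swap_computed[OF Ld]] i by simp
  ultimately show ?case using F' G' Pd Qd U' by (intro exI[of _ "Suc m"]) simp
qed

text \<open>\<open>U'\<close> itself is only given implicitly by the factorization of the enlarged matrix; as \<open>L\<close> is
  invertible, its part inside the old border is nevertheless the old factor.\<close>

lemma upper_left_breakdown_factor:
  assumes M: "M \<in> carrier_mat n n" and F: "F \<in> carrier_mat n m" and G: "G \<in> carrier_mat n m"
    and P: "P \<in> carrier_mat (n + m) (n + m)" and Q: "Q \<in> carrier_mat (n + m) (n + m)"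
    and U: "U \<in> carrier_mat (n + m) (n + m)" and L: "partial_lower (n + m) i L"
    and fac: "P * bordered_mat M F G * Q = L * U"
    and i: "i < n + m" "c < n + m"
    and U': "U' \<in> carrier_mat (Suc (n + m)) (Suc (n + m))"
    and fac': "diag_ext P * bordered_mat M (add_col F f) (add_col G g) * diag_ext (swapcols i c Q)
      = diag_ext L * U'"
  shows "upper_left (n + m) U' = swapcols i c U"
proof -
  let ?N = "n + m" and ?B = "bordered_mat M F G"
  let ?B' = "bordered_mat M (add_col F f) (add_col G g)"
  let ?C = "swaprows_mat ?N i c :: complex mat"
  have Lc: "L \<in> carrier_mat ?N ?N" using L by (simp add: partial_lower_def)
  have B: "?B \<in> carrier_mat ?N ?N" using bordered_mat_carrier[OF M F G] .
  have B': "?B' \<in> carrier_mat (Suc ?N) (Suc ?N)"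
    using bordered_mat_carrier[OF M add_col_carrier[OF F] add_col_carrier[OF G]] by simp
  have Q': "swapcols i c Q \<in> carrier_mat ?N ?N" using Q by simp
  \<comment> \<open>Deleting the last row and column on both sides of \<open>fac'\<close> leaves
    \<open>fac\<close> with columns \<open>i\<close> and \<open>c\<close> interchanged; then
    \<open>L\<close> is cancelled.\<close>
  have "L * upper_left ?N U' = upper_left ?N (diag_ext L * U')"
    by (rule upper_left_diag_ext_mult[OF Lc U', symmetric])
  also have "\<dots> = P * ?B * swapcols i c Q"
    unfolding fac'[symmetric]
      upper_left_mult_diag_ext[OF Q' mult_carrier_mat[OF diag_ext_carrier[OF P] B']]
      upper_left_diag_ext_mult[OF P B'] upper_left_bordered_mat_add_col[OF M F G] ..
  also have "\<dots> = P * ?B * Q * ?C"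
    unfolding swapcols_mat[OF Q i] using P B Q
    by (intro assoc_mult_mat[of _ ?N ?N _ ?N _ ?N, symmetric]) auto
  also have "\<dots> = L * swapcols i c U"
    unfolding fac swapcols_mat[OF U i] using Lc U
    by (intro assoc_mult_mat[of _ ?N ?N _ ?N _ ?N]) auto
  finally have eq: "L * upper_left ?N U' = L * swapcols i c U" .
  have "upper_left ?N U' \<in> carrier_mat ?N ?N" "swapcols i c U \<in> carrier_mat ?N ?N"
    using U by (simp_all add: upper_left_def)
  then show ?thesis using eq by (rule partial_lower_mult_cancel[OF L])
qed

text \<open>\<open>J\<close> collects the breakdown steps, each of which adds one border column.
  Agreement of \<open>U\<close> and \<open>W\<close> is confined to rows from \<open>i\<close> on: a
  row finished by a breakdown carries \<alpha> in \<open>U\<close> and is zero in \<open>W\<close>.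
  Later pivots and multipliers are read only from the rows where both agree.\<close>

lemma blu_steps_reduced:
  assumes "blu_steps n \<alpha> M i F G P Q L U" and M: "M \<in> carrier_mat n n"
  shows "\<exists>W J. W \<in> carrier_mat (n + dim_col F) n \<and> reduced_upto i J W \<and> card J = dim_col F \<and>
    vec_space.rank (n + dim_col F) W = vec_space.rank n M \<and>
    (\<forall>k j. i \<le> k \<longrightarrow> k < n + dim_col F \<longrightarrow> j < n \<longrightarrow> U $$ (k, j) = W $$ (k, j))"
  using assms(1)
proof induction
  case start
  show ?case using M by (intro exI[of _ M] exI[of _ "{}"]) (auto simp: reduced_upto_def)
next
  case (pivot i F G P Q L U r c U')
  let ?N = "n + dim_col F"
  from pivot.IH obtain W J where W: "W \<in> carrier_mat ?N n" and red: "reduced_upto i J W"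
    and J: "card J = dim_col F" and rk: "vec_space.rank ?N W = vec_space.rank n M"
    and UW: "\<And>k j. i \<le> k \<Longrightarrow> k < ?N \<Longrightarrow> j < n \<Longrightarrow> U $$ (k, j) = W $$ (k, j)"
    by blast
  from blu_steps_factorization[OF pivot.hyps(1) M] have U: "U \<in> carrier_mat ?N ?N" by auto
  have i: "i < n" "i \<le> r" "r < ?N" "i \<le> c" "c < n" using pivot.hyps(2-4) U by auto
  let ?V = "swapcols i c (swaprows i r W)"
  have V: "?V \<in> carrier_mat ?N n" using W by simp
  have U': "U' \<in> carrier_mat ?N ?N" using U pivot.hyps(6) by simp
  have U'V: "U' $$ (k, j) = ?V $$ (k, j)" if "i \<le> k" "k < ?N" "j < n" for k j
    using that i U W UW unfolding pivot.hyps(6) by simp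
  have "W $$ (r, c) \<noteq> 0" using pivot.hyps(5) UW[of r c] i by simp
  then have "reduced_upto (Suc i) J (eliminate_below i ?V)"
    using W red i by (intro reduced_upto_pivot) auto
  moreover have "vec_space.rank ?N (eliminate_below i ?V) = vec_space.rank n M"
    using rank_eliminate_below[OF V] rank_swapcols[of "swaprows i r W" ?N n i c] rank_swaprows[OF W] W i rk
    by simp
  moreover have "eliminate_below i ?V \<in> carrier_mat ?N n" using V by (simp add: eliminate_below_def)
  \<comment> \<open>The elimination in row \<open>k\<close> reads only rows \<open>k\<close> and
    \<open>i\<close>, and both lie in the range of \<open>U'V\<close>.\<close>
  moreover have "eliminate_below i U' $$ (k, j) = eliminate_below i ?V $$ (k, j)"
    if "Suc i \<le> k" "k < ?N" "j < n" for k j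
    using that i eliminate_below_index[OF V, of k j] eliminate_below_index[OF U', of k j]
      U'V[of k j] U'V[of k i] U'V[of i j] U'V[of i i]
    by (simp del: index_mat_swapcols index_mat_swaprows)
  ultimately show ?case using J by blast
next
  case (breakdown i F G P Q L U c Q' m f g U')
  let ?N = "n + m"
  from breakdown.IH breakdown.hyps(6) obtain W J where W: "W \<in> carrier_mat ?N n"
    and red: "reduced_upto i J W"
    and J: "card J = m" and rk: "vec_space.rank ?N W = vec_space.rank n M"
    and UW: "\<And>k j. i \<le> k \<Longrightarrow> k < ?N \<Longrightarrow> j < n \<Longrightarrow> U $$ (k, j) = W $$ (k, j)"
    by blast
  have i: "i < n" "i \<le> c" "c < n" using breakdown.hyps(2,3) by auto
  from blu_steps_factorization[OF breakdown.hyps(1) M] breakdown.hyps(6)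
  have F: "F \<in> carrier_mat n m" and G: "G \<in> carrier_mat n m"
    and P: "P \<in> carrier_mat ?N ?N" and Q: "Q \<in> carrier_mat ?N ?N"
    and U: "U \<in> carrier_mat ?N ?N" and L: "partial_lower ?N i L"
    and fac: "P * bordered_mat M F G * Q = L * U"
    by auto
  have U': "U' \<in> carrier_mat (Suc ?N) (Suc ?N)" using breakdown.hyps(10) by simp
  have UL: "upper_left ?N U' = swapcols i c U"
    using i breakdown.hyps(11)[unfolded breakdown.hyps(5)]
    by (intro upper_left_breakdown_factor[OF M F G P Q U L fac _ _ U']) simp_all
  let ?S = "swapcols i c W"
  let ?V = "swaprows i ?N (add_zero_row ?S)"
  have S: "?S \<in> carrier_mat ?N n" using W by simp
  have Z: "add_zero_row ?S \<in> carrier_mat (Suc ?N) n" using W by (simp add: add_zero_row_def)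
  have "W $$ (k, c) = 0" if "i \<le> k" "k < ?N" for k
    using breakdown.hyps(4) UW[of k c] that i U by simp
  then have "reduced_upto (Suc i) (insert i J) ?V"
    using W red i by (intro reduced_upto_breakdown) auto
  moreover have "vec_space.rank (Suc ?N) ?V = vec_space.rank n M"
    using rank_swaprows[OF Z, of i ?N] rank_add_zero_row[OF S] rank_swapcols[OF W] i rk by simp
  moreover have "?V \<in> carrier_mat (Suc ?N) n" using Z by simp
  \<comment> \<open>All earlier breakdowns have an index below \<open>i\<close>, so \<open>i\<close>
    is new in \<open>J\<close>.\<close>
  moreover have "card (insert i J) = Suc m"
    using red J finite_subset[of J "{..<i}"] by (auto simp: reduced_upto_def card_insert_if)
  moreover have "swaprows i ?N U' $$ (k, j) = ?V $$ (k, j)"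
    if k: "Suc i \<le> k" "k < Suc ?N" and j: "j < n" for k j
  proof -
    \<comment> \<open>Row \<open>k\<close> after the interchange is row \<open>?k\<close> before it,
      which lies inside the old border. The new row \<open>i\<close>, zero in \<open>?V\<close>, is
      excluded by \<open>Suc i \<le> k\<close>.\<close>
    let ?k = "if k = ?N then i else k"
    have k': "?k < ?N" "i \<le> ?k" using k i by auto
    have "swaprows i ?N U' $$ (k, j) = U' $$ (?k, j)" using k j U' by simp
    also have "\<dots> = swapcols i c U $$ (?k, j)"
      using k' j unfolding UL[symmetric] by (simp add: upper_left_def)
    also have "\<dots> = swapcols i c W $$ (?k, j)"
      using k' j i U W UW by simp
    also have "\<dots> = ?V $$ (k, j)" using k j i W by (simp add: add_zero_row_def)
    finally show ?thesis .
  qed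
  moreover have dim: "dim_col (add_col F f) = Suc m" using add_col_carrier[OF F, of f] by simp
  ultimately show ?case
    unfolding dim add_Suc_right by (intro exI[of _ ?V] exI[of _ "insert i J"] conjI allI impI)
qed

theorem theorem4p3:
  fixes A B F G :: "complex mat" and \<sigma> \<alpha> :: complex and n k :: nat
  assumes "A \<in> carrier_mat n n" and "B \<in> carrier_mat n n"
    and "\<alpha> \<noteq> 0"
    and "k = vec_space.rank n (A - \<sigma> \<cdot>\<^sub>m B)"
    and "blu_borders n \<alpha> (A - \<sigma> \<cdot>\<^sub>m B) F G"
  shows "dim_col F = n - k \<and> dim_col G = n - k"
proof -
  let ?M = "A - \<sigma> \<cdot>\<^sub>m B"
  have M: "?M \<in> carrier_mat n n" using assms by (simp add: minus_carrier_mat)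
  from assms(5) obtain P Q L U where steps: "blu_steps n \<alpha> ?M n F G P Q L U"
    unfolding blu_borders_def by blast
  from blu_steps_reduced[OF steps M] obtain W :: "complex mat" and J where
    W: "W \<in> carrier_mat (n + dim_col F) n" and red: "reduced_upto n J W"
    and J: "card J = dim_col F" and rk: "vec_space.rank (n + dim_col F) W = vec_space.rank n ?M"
    by blast
  have "k = n - dim_col F" using rank_reduced[OF W _ red] rk assms(4) J by simp
  \<comment> \<open>Subtraction on \<open>nat\<close> truncates, so this bound is what allows
    solving \<open>k = n - dim_col F\<close> for \<open>dim_col F\<close>.\<close>
  moreover have "dim_col F \<le> n"
    using red J card_mono[of "{..<n}" J] by (auto simp: reduced_upto_def)
  moreover have "dim_col G = dim_col F" using blu_steps_factorization[OF steps M] by auto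
  ultimately show ?thesis by simp
qed

end
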